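(* Let $\theta$ be an irrational real number and let $\omega=(\omega_1,\omega_2)\in\mathbb{C}^2$. (a) If $g$ is an element of $SL(2,\mathbb{Z})$, then there is an equivalence of categories $\mathsf{Vect}(\mathbb{T}_\theta^{g\omega})\simeq\mathsf{Vect}(\mathbb{T}_\theta^{\omega})$. (b) If $\omega_2\neq0$ and $\tau=\frac{\omega_1}{\omega_2}$, then there is an equivalence of categories $\mathsf{Vect}(\mathbb{T}_\theta^{\omega})\simeq\mathsf{Vect}(\mathbb{T}_\theta^{\tau})$.
   Context: $\mathcal{A}_\theta$ is the algebra of smooth functions on the noncommutative torus: elements are sums $\sum_{(n_1,n_2)\in\mathbb{Z}^2}a_{n_1,n_2}U_1^{n_1}U_2^{n_2}$ with rapidly decreasing complex coefficients, with $U_1,U_2$ unitaries satisfying $U_2U_1=e^{2\pi i\theta}U_1U_2$. Its basic derivations $\delta_1,\delta_2$ are given by $$\delta_j\Big(\sum a_{n_1,n_2}U_1^{n_1}U_2^{n_2}\Big)=2\pi i\sum n_j a_{n_1,n_2}U_1^{n_1}U_2^{n_2}.$$ For $\omega=(\omega_1,\omega_2)\in\mathbb{C}^2$ put $\delta_\omega=\omega_1\delta_1+\omega_2\delta_2$; $g\in SL(2,\mathbb{Z})$ acts on $\omega$, viewed as a column vector, by matrix multiplication. The category $\mathsf{Vect}(\mathbb{T}_\theta^\omega)$ has as objects pairs $(E,\nabla)$ with $E$ a finitely generated projective right $\mathcal{A}_\theta$-module and $\nabla:E\to E$ a $\mathbb{C}$-linear map satisfying $\nabla(ea)=\nabla(e)a+e\,\delta_\omega(a)$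 for all $e\in E$, $a\in\mathcal{A}_\theta$; morphisms are $\mathcal{A}_\theta$-module maps commuting with the connections. For $\tau\in\mathbb{C}$, $\mathsf{Vect}(\mathbb{T}_\theta^\tau)$ denotes $\mathsf{Vect}(\mathbb{T}_\theta^{\omega})$ with $\omega=(\tau,1)$. *)

theory Defs
  imports "HOL-Analysis.Analysis" "HOL-Algebra.Ring"
begin

section \<open>Categories and equivalences\<close>

text \<open>
  Categories are given by hom-sets indexed by pairs of objects; hom-sets of different pairs
  need not be disjoint, so composition and the arrow part of a functor take the objects as
  arguments. \<open>Cmp C X Y Z g f\<close> is the composite of \<open>f : X \<rightarrow> Y\<close> and \<open>g : Y \<rightarrow> Z\<close>.
\<close>

record ('o, 'h) cat =
  Obj :: "'o set"
  Hom :: "'o \<Rightarrow> 'o \<Rightarrow> 'h set"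
  Idt :: "'o \<Rightarrow> 'h"
  Cmp :: "'o \<Rightarrow> 'o \<Rightarrow> 'o \<Rightarrow> 'h \<Rightarrow> 'h \<Rightarrow> 'h"

locale category =
  fixes C :: "('o, 'h) cat"
  assumes Idt_closed: "X \<in> Obj C \<Longrightarrow> Idt C X \<in> Hom C X X"
    and Cmp_closed:
      "\<lbrakk>X \<in> Obj C; Y \<in> Obj C; Z \<in> Obj C; f \<in> Hom C X Y; g \<in> Hom C Y Z\<rbrakk>
        \<Longrightarrow> Cmp C X Y Z g f \<in> Hom C X Z"
    and Cmp_Idt_right:
      "\<lbrakk>X \<in> Obj C; Y \<in> Obj C; f \<in> Hom C X Y\<rbrakk> \<Longrightarrow> Cmp C X X Y f (Idt C X) = f"
    and Cmp_Idt_left: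
      "\<lbrakk>X \<in> Obj C; Y \<in> Obj C; f \<in> Hom C X Y\<rbrakk> \<Longrightarrow> Cmp C X Y Y (Idt C Y) f = f"
    and Cmp_assoc:
      "\<lbrakk>W \<in> Obj C; X \<in> Obj C; Y \<in> Obj C; Z \<in> Obj C;
        f \<in> Hom C W X; g \<in> Hom C X Y; h \<in> Hom C Y Z\<rbrakk>
        \<Longrightarrow> Cmp C W X Z (Cmp C X Y Z h g) f = Cmp C W Y Z h (Cmp C W X Y g f)"

record ('o, 'h, 'p, 'k) funct =
  on_obj :: "'o \<Rightarrow> 'p"
  on_arr :: "'o \<Rightarrow> 'o \<Rightarrow> 'h \<Rightarrow> 'k"

locale is_functor = source: category C + target: category D
  for C :: "('o, 'h) cat" and D :: "('p, 'k) cat" +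
  fixes F :: "('o, 'h, 'p, 'k) funct"
  assumes on_obj_closed: "X \<in> Obj C \<Longrightarrow> on_obj F X \<in> Obj D"
    and on_arr_closed:
      "\<lbrakk>X \<in> Obj C; Y \<in> Obj C; f \<in> Hom C X Y\<rbrakk>
        \<Longrightarrow> on_arr F X Y f \<in> Hom D (on_obj F X) (on_obj F Y)"
    and on_arr_Idt: "X \<in> Obj C \<Longrightarrow> on_arr F X X (Idt C X) = Idt D (on_obj F X)"
    and on_arr_Cmp:
      "\<lbrakk>X \<in> Obj C; Y \<in> Obj C; Z \<in> Obj C; f \<in> Hom C X Y; g \<in> Hom C Y Z\<rbrakk>
        \<Longrightarrow> on_arr F X Z (Cmp C X Y Z g f) =
          Cmp D (on_obj F X) (on_obj F Y) (on_obj F Z) (on_arr F Y Z g) (on_arr F X Y f)"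

definition id_funct :: "('o, 'h, 'o, 'h) funct" where
  "id_funct = \<lparr>on_obj = (\<lambda>X. X), on_arr = (\<lambda>X Y f. f)\<rparr>"

definition comp_funct ::
  "('p, 'k, 'q, 'l) funct \<Rightarrow> ('o, 'h, 'p, 'k) funct \<Rightarrow> ('o, 'h, 'q, 'l) funct" where
  "comp_funct G F =
    \<lparr>on_obj = (\<lambda>X. on_obj G (on_obj F X)),
     on_arr = (\<lambda>X Y f. on_arr G (on_obj F X) (on_obj F Y) (on_arr F X Y f))\<rparr>"

definition iso_arrow :: "('o, 'h) cat \<Rightarrow> 'o \<Rightarrow> 'o \<Rightarrow> 'h \<Rightarrow> bool" where
  "iso_arrow C X Y f \<longleftrightarrow> f \<in> Hom C X Y \<and>
    (\<exists>g \<in> Hom C Y X. Cmp C X Y X g f = Idt C X \<and> Cmp C Y X Y f g = Idt C Y)"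

definition naturally_isomorphic ::
  "('o, 'h) cat \<Rightarrow> ('p, 'k) cat \<Rightarrow> ('o, 'h, 'p, 'k) funct \<Rightarrow> ('o, 'h, 'p, 'k) funct \<Rightarrow> bool"
where
  "naturally_isomorphic C D F G \<longleftrightarrow>
    (\<exists>\<eta>. (\<forall>X \<in> Obj C. iso_arrow D (on_obj F X) (on_obj G X) (\<eta> X)) \<and>
      (\<forall>X \<in> Obj C. \<forall>Y \<in> Obj C. \<forall>f \<in> Hom C X Y.
        Cmp D (on_obj F X) (on_obj F Y) (on_obj G Y) (\<eta> Y) (on_arr F X Y f) =
        Cmp D (on_obj F X) (on_obj G X) (on_obj G Y) (on_arr G X Y f) (\<eta> X)))"

definition equivalent_categories :: "('o, 'h) cat \<Rightarrow> ('p, 'k) cat \<Rightarrow> bool"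
where
  "equivalent_categories C D \<longleftrightarrow>
    (\<exists>F G. is_functor C D F \<and> is_functor D C G \<and>
      naturally_isomorphic C C id_funct (comp_funct G F) \<and>
      naturally_isomorphic D D (comp_funct F G) id_funct)"


section \<open>Right modules over a not necessarily commutative ring\<close>

text \<open>
  As in the library's \<open>module\<close>, only the carrier and the additive fields of the underlying
  ring record are relevant.
\<close>

record ('a, 'm) right_mod = "'m ring" +
  ract :: "'m \<Rightarrow> 'a \<Rightarrow> 'm" (infixl "\<triangleleft>\<index>" 70)

locale right_module = R?: ring R + M?: abelian_group M
  for R :: "('a, 'r) ring_scheme" (structure) and M :: "('a, 'm, 'x) right_mod_scheme" (structure) +
  assumes ract_closed: "\<lbrakk>x \<in> carrier M; a \<in> carrier R\<rbrakk> \<Longrightarrow> x \<triangleleft>\<^bsub>M\<^esub> a \<in> carrier M"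
    and ract_add_left:
      "\<lbrakk>x \<in> carrier M; y \<in> carrier M; a \<in> carrier R\<rbrakk>
        \<Longrightarrow> (x \<oplus>\<^bsub>M\<^esub> y) \<triangleleft>\<^bsub>M\<^esub> a = x \<triangleleft>\<^bsub>M\<^esub> a \<oplus>\<^bsub>M\<^esub> y \<triangleleft>\<^bsub>M\<^esub> a"
    and ract_add_right:
      "\<lbrakk>x \<in> carrier M; a \<in> carrier R; b \<in> carrier R\<rbrakk>
        \<Longrightarrow> x \<triangleleft>\<^bsub>M\<^esub> (a \<oplus>\<^bsub>R\<^esub> b) = x \<triangleleft>\<^bsub>M\<^esub> a \<oplus>\<^bsub>M\<^esub> x \<triangleleft>\<^bsub>M\<^esub> b"
    and ract_mult:
      "\<lbrakk>x \<in> carrier M; a \<in> carrier R; b \<in> carrier R\<rbrakk>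
        \<Longrightarrow> x \<triangleleft>\<^bsub>M\<^esub> (a \<otimes>\<^bsub>R\<^esub> b) = (x \<triangleleft>\<^bsub>M\<^esub> a) \<triangleleft>\<^bsub>M\<^esub> b"
    and ract_one: "x \<in> carrier M \<Longrightarrow> x \<triangleleft>\<^bsub>M\<^esub> \<one>\<^bsub>R\<^esub> = x"

text \<open>Homomorphisms are extensional on the carrier, so that equal maps are equal as terms.\<close>

definition right_module_hom ::
  "('a, 'r) ring_scheme \<Rightarrow> ('a, 'm, 'x) right_mod_scheme \<Rightarrow> ('a, 'n, 'y) right_mod_scheme
    \<Rightarrow> ('m \<Rightarrow> 'n) set"
where
  "right_module_hom R M N =
    {f \<in> carrier M \<rightarrow>\<^sub>E carrier N.
      (\<forall>x \<in> carrier M. \<forall>y \<in> carrier M. f (x \<oplus>\<^bsub>M\<^esub> y) = f x \<oplus>\<^bsub>N\<^esub> f y) \<and>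
      (\<forall>x \<in> carrier M. \<forall>a \<in> carrier R. f (x \<triangleleft>\<^bsub>M\<^esub> a) = f x \<triangleleft>\<^bsub>N\<^esub> a)}"

definition right_submodule ::
  "('a, 'r) ring_scheme \<Rightarrow> 'm set \<Rightarrow> ('a, 'm, 'x) right_mod_scheme \<Rightarrow> bool" where
  "right_submodule R P M \<longleftrightarrow> P \<subseteq> carrier M \<and> right_module R (M\<lparr>carrier := P\<rparr>)"

text \<open>The free right module on a set \<open>I\<close>: finitely supported families, extended by zero.\<close>

definition free_right_module ::
  "('a, 'r) ring_scheme \<Rightarrow> 'i set \<Rightarrow> ('a, 'i \<Rightarrow> 'a) right_mod" where
  "free_right_module R I =
    \<lparr>carrier = {v. (\<forall>i. v i \<in> carrier R) \<and> (\<forall>i. i \<notin> I \<longrightarrow> v i = \<zero>\<^bsub>R\<^esub>) \<and> finite {i. v i \<noteq> \<zero>\<^bsub>R\<^esub>}},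
     mult = undefined,
     one = undefined,
     zero = (\<lambda>i. \<zero>\<^bsub>R\<^esub>),
     add = (\<lambda>v w i. v i \<oplus>\<^bsub>R\<^esub> w i),
     ract = (\<lambda>v a i. v i \<otimes>\<^bsub>R\<^esub> a)\<rparr>"

definition finitely_generated ::
  "('a, 'r) ring_scheme \<Rightarrow> ('a, 'm, 'x) right_mod_scheme \<Rightarrow> bool" where
  "finitely_generated R M \<longleftrightarrow>
    (\<exists>S. finite S \<and> S \<subseteq> carrier M \<and>
      (\<forall>x \<in> carrier M. \<exists>c \<in> S \<rightarrow> carrier R. x = (\<Oplus>\<^bsub>M\<^esub>s\<in>S. s \<triangleleft>\<^bsub>M\<^esub> c s)))"

text \<open>
  A projective module is one isomorphic to a direct summand of a free module. Taking the index set
  of the free module inside the type of \<open>M\<close> loses nothing: \<open>M\<close> is a quotient of the free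
  module on \<open>carrier M\<close>, and a direct summand of it if it is projective.
\<close>

definition projective ::
  "('a, 'r) ring_scheme \<Rightarrow> ('a, 'm, 'x) right_mod_scheme \<Rightarrow> bool" where
  "projective R M \<longleftrightarrow>
    (\<exists>(I :: 'm set) P Q.
      right_submodule R P (free_right_module R I) \<and>
      right_submodule R Q (free_right_module R I) \<and>
      (\<forall>v \<in> carrier (free_right_module R I).
        \<exists>!(p, q). p \<in> P \<and> q \<in> Q \<and> v = p \<oplus>\<^bsub>free_right_module R I\<^esub> q) \<and>
      (\<exists>f \<in> right_module_hom R M ((free_right_module R I)\<lparr>carrier := P\<rparr>).
        bij_betw f (carrier M) P))"


section \<open>Smooth functions on the noncommutative torus\<close>

text \<open>
  An element \<open>\<Sum> a(n\<^sub>1,n\<^sub>2) U\<^sub>1^n\<^sub>1 U\<^sub>2^n\<^sub>2\<close> is represented by its coefficient function.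
  The relation \<open>U\<^sub>2 U\<^sub>1 = exp(2 \<pi> i \<theta>) U\<^sub>1 U\<^sub>2\<close> gives
  \<open>(U\<^sub>1^m\<^sub>1 U\<^sub>2^m\<^sub>2) (U\<^sub>1^n\<^sub>1 U\<^sub>2^n\<^sub>2) =
   exp(2 \<pi> i \<theta> m\<^sub>2 n\<^sub>1) U\<^sub>1^(m\<^sub>1+n\<^sub>1) U\<^sub>2^(m\<^sub>2+n\<^sub>2)\<close>, whence the twisted convolution below.
\<close>

type_synonym nc_fun = "int \<times> int \<Rightarrow> complex"

definition rapidly_decreasing :: "nc_fun \<Rightarrow> bool" where
  "rapidly_decreasing a \<longleftrightarrow>
    (\<forall>k::nat. \<exists>C::real. \<forall>n. (1 + \<bar>real_of_int (fst n)\<bar> + \<bar>real_of_int (snd n)\<bar>) ^ k * norm (a n) \<le> C)"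

definition nc_mult :: "real \<Rightarrow> nc_fun \<Rightarrow> nc_fun \<Rightarrow> nc_fun" where
  "nc_mult \<theta> a b =
    (\<lambda>n. \<Sum>\<^sub>\<infinity>m\<in>UNIV. a m * b (n - m) * cis (2 * pi * \<theta> * of_int (snd m * fst (n - m))))"

definition nc_monomial :: "int \<times> int \<Rightarrow> nc_fun" where
  "nc_monomial m = (\<lambda>n. if n = m then 1 else 0)"

definition nc_torus :: "real \<Rightarrow> nc_fun ring" where
  "nc_torus \<theta> =
    \<lparr>carrier = {a. rapidly_decreasing a},
     mult = nc_mult \<theta>,
     one = nc_monomial (0, 0),
     zero = (\<lambda>n. 0),
     add = (\<lambda>a b n. a n + b n)\<rparr>"

definition nc_U1 :: nc_fun where "nc_U1 = nc_monomial (1, 0)"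
definition nc_U2 :: nc_fun where "nc_U2 = nc_monomial (0, 1)"

definition nc_scalar :: "complex \<Rightarrow> nc_fun" where
  "nc_scalar c = (\<lambda>n. c * nc_monomial (0, 0) n)"

lemma nc_mult_monomial:
  "nc_mult \<theta> (nc_monomial m) (nc_monomial n) =
    (\<lambda>k. cis (2 * pi * \<theta> * of_int (snd m * fst n)) * nc_monomial (m + n) k)"
proof
  fix k
  have "nc_mult \<theta> (nc_monomial m) (nc_monomial n) k =
      (\<Sum>\<^sub>\<infinity>l\<in>{m}. nc_monomial m l * nc_monomial n (k - l) *
        cis (2 * pi * \<theta> * of_int (snd l * fst (k - l))))"
    unfolding nc_mult_def by (rule infsum_cong_neutral) (auto simp: nc_monomial_def)
  then show "nc_mult \<theta> (nc_monomial m) (nc_monomial n) k =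
      cis (2 * pi * \<theta> * of_int (snd m * fst n)) * nc_monomial (m + n) k"
    by (auto simp: nc_monomial_def algebra_simps)
qed

lemma nc_torus_relation:
  "nc_mult \<theta> nc_U2 nc_U1 = (\<lambda>n. cis (2 * pi * \<theta>) * nc_mult \<theta> nc_U1 nc_U2 n)"
  by (simp add: nc_U1_def nc_U2_def nc_mult_monomial)

definition nc_delta1 :: "nc_fun \<Rightarrow> nc_fun" where
  "nc_delta1 a = (\<lambda>n. 2 * of_real pi * \<i> * of_int (fst n) * a n)"

definition nc_delta2 :: "nc_fun \<Rightarrow> nc_fun" where
  "nc_delta2 a = (\<lambda>n. 2 * of_real pi * \<i> * of_int (snd n) * a n)"

definition nc_delta :: "complex ^ 2 \<Rightarrow> nc_fun \<Rightarrow> nc_fun" where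
  "nc_delta \<omega> a = (\<lambda>n. \<omega> $ 1 * nc_delta1 a n + \<omega> $ 2 * nc_delta2 a n)"


section \<open>The category of modules with connection\<close>

text \<open>
  A complex scalar \<open>c\<close> acts on a right module through the element \<open>c \<cdot> 1\<close> of the algebra.
  The map is extensional on the carrier.
\<close>

definition nc_connection ::
  "real \<Rightarrow> complex ^ 2 \<Rightarrow> (nc_fun, 'm) right_mod \<Rightarrow> ('m \<Rightarrow> 'm) \<Rightarrow> bool" where
  "nc_connection \<theta> \<omega> E D \<longleftrightarrow>
    D \<in> carrier E \<rightarrow>\<^sub>E carrier E \<and>
    (\<forall>e \<in> carrier E. \<forall>e' \<in> carrier E. D (e \<oplus>\<^bsub>E\<^esub> e') = D e \<oplus>\<^bsub>E\<^esub> D e') \<and>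
    (\<forall>e \<in> carrier E. \<forall>c. D (e \<triangleleft>\<^bsub>E\<^esub> nc_scalar c) = D e \<triangleleft>\<^bsub>E\<^esub> nc_scalar c) \<and>
    (\<forall>e \<in> carrier E. \<forall>a \<in> carrier (nc_torus \<theta>).
      D (e \<triangleleft>\<^bsub>E\<^esub> a) = D e \<triangleleft>\<^bsub>E\<^esub> a \<oplus>\<^bsub>E\<^esub> e \<triangleleft>\<^bsub>E\<^esub> nc_delta \<omega> a)"

type_synonym 'm nc_bundle = "(nc_fun, 'm) right_mod \<times> ('m \<Rightarrow> 'm)"

text \<open>
  The type \<open>'m\<close> plays the role of a universe: the underlying sets of the modules are the subsets
  of \<open>'m\<close>. Every finitely generated module over the algebra has at most the cardinality of the
  continuum, so any \<open>'m\<close> at least that large realises all of them up to isomorphism.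
\<close>

definition Vect ::
  "'m itself \<Rightarrow> real \<Rightarrow> complex ^ 2 \<Rightarrow> ('m nc_bundle, 'm \<Rightarrow> 'm) cat" where
  "Vect _ \<theta> \<omega> =
    \<lparr>Obj = {(E, D). right_module (nc_torus \<theta>) E \<and> finitely_generated (nc_torus \<theta>) E \<and>
        projective (nc_torus \<theta>) E \<and> nc_connection \<theta> \<omega> E D},
     Hom = (\<lambda>(E, D) (E', D').
        {f \<in> right_module_hom (nc_torus \<theta>) E E'. \<forall>e \<in> carrier E. f (D e) = D' (f e)}),
     Idt = (\<lambda>(E, D). \<lambda>e \<in> carrier E. e),
     Cmp = (\<lambda>(E, D) _ _ g f. compose (carrier E) g f)\<rparr>"

definition Vect_tau ::
  "'m itself \<Rightarrow> real \<Rightarrow> complex \<Rightarrow> ('m nc_bundle, 'm \<Rightarrow> 'm) cat" where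
  "Vect_tau T \<theta> \<tau> = Vect T \<theta> (vector [\<tau>, 1])"

end

theory Submission
  imports Defs
begin

text \<open>
  Both equivalences are strict isomorphisms of categories that are the identity on underlying sets
  and on morphisms. For (a), a matrix \<open>h\<close> of determinant 1 induces an automorphism of the algebra
  which intertwines the derivations \<open>\<delta>\<^sub>\<omega>\<close> up to the action of the transpose of \<open>h\<close> on \<open>\<omega>\<close>, and
  restriction of scalars along it keeps the connection. In the Weyl-ordered generators
  \<open>exp(\<pi> i \<theta> n\<^sub>1 n\<^sub>2) U\<^sub>1^n\<^sub>1 U\<^sub>2^n\<^sub>2\<close> the structure constants depend only on the symplectic form, so the
  automorphism just permutes these generators. For (b), one multiplies the connection by the
  scalar \<open>1 / \<omega>\<^sub>2\<close>.
\<close>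

section \<open>Isomorphisms of categories\<close>

text \<open>Both functors leave arrows unchanged, so functoriality reduces to the assumed equalities
  of hom-sets, identities and composites. As \<open>\<Psi>\<close> and \<open>\<Phi>\<close> undo
  each other exactly, identities serve as components of both natural isomorphisms.\<close>

lemma equivalent_categories_if_iso:
  fixes C :: "('o, 'h) cat" and D :: "('p, 'h) cat"
  assumes C: "category C" and D: "category D"
    and \<Phi>: "\<And>X. X \<in> Obj C \<Longrightarrow> \<Phi> X \<in> Obj D" and \<Psi>: "\<And>Y. Y \<in> Obj D \<Longrightarrow> \<Psi> Y \<in> Obj C"
    and \<Psi>\<Phi>: "\<And>X. X \<in> Obj C \<Longrightarrow> \<Psi> (\<Phi> X) = X" and \<Phi>\<Psi>: "\<And>Y. Y \<in> Obj D \<Longrightarrow> \<Phi> (\<Psi> Y) = Y"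
    and Hom: "\<And>X Y. \<lbrakk>X \<in> Obj C; Y \<in> Obj C\<rbrakk> \<Longrightarrow> Hom D (\<Phi> X) (\<Phi> Y) = Hom C X Y"
    and Idt: "\<And>X. X \<in> Obj C \<Longrightarrow> Idt D (\<Phi> X) = Idt C X"
    and Cmp: "\<And>X Y Z. \<lbrakk>X \<in> Obj C; Y \<in> Obj C; Z \<in> Obj C\<rbrakk>
      \<Longrightarrow> Cmp D (\<Phi> X) (\<Phi> Y) (\<Phi> Z) = Cmp C X Y Z"
  shows "equivalent_categories C D"
proof -
  interpret C: category C by (rule C)
  interpret D: category D by (rule D)
  define F :: "('o, 'h, 'p, 'h) funct" where "F = \<lparr>on_obj = \<Phi>, on_arr = (\<lambda>X Y f. f)\<rparr>"
  define G :: "('p, 'h, 'o, 'h) funct" where "G = \<lparr>on_obj = \<Psi>, on_arr = (\<lambda>X Y f. f)\<rparr>"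
  \<comment> \<open>The assumptions concern \<open>\<Phi>\<close>; evaluated at objects
    \<open>\<Psi> X\<close> they yield the same equalities for \<open>\<Psi>\<close>.\<close>
  have Hom': "Hom C (\<Psi> X) (\<Psi> Y) = Hom D X Y" if "X \<in> Obj D" "Y \<in> Obj D" for X Y
    using Hom[of "\<Psi> X" "\<Psi> Y"] that \<Psi> \<Phi>\<Psi> by simp
  have Idt': "Idt C (\<Psi> X) = Idt D X" if "X \<in> Obj D" for X
    using Idt[of "\<Psi> X"] that \<Psi> \<Phi>\<Psi> by simp
  have Cmp': "Cmp C (\<Psi> X) (\<Psi> Y) (\<Psi> Z) = Cmp D X Y Z"
    if "X \<in> Obj D" "Y \<in> Obj D" "Z \<in> Obj D" for X Y Z
    using Cmp[of "\<Psi> X" "\<Psi> Y" "\<Psi> Z"] that \<Psi> \<Phi>\<Psi> by simp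
  have "is_functor C D F"
    by unfold_locales (simp_all add: F_def \<Phi> Hom Idt Cmp)
  moreover have "is_functor D C G"
    by unfold_locales (simp_all add: G_def \<Psi> Hom' Idt' Cmp')
  moreover have "naturally_isomorphic C C id_funct (comp_funct G F)"
    unfolding naturally_isomorphic_def
    by (rule exI[of _ "Idt C"])
      (auto simp: id_funct_def comp_funct_def F_def G_def \<Psi>\<Phi> iso_arrow_def C.Idt_closed
        C.Cmp_Idt_left C.Cmp_Idt_right)
  moreover have "naturally_isomorphic D D (comp_funct F G) id_funct"
    unfolding naturally_isomorphic_def
    by (rule exI[of _ "Idt D"])
      (auto simp: id_funct_def comp_funct_def F_def G_def \<Phi>\<Psi> iso_arrow_def D.Idt_closed
        D.Cmp_Idt_left D.Cmp_Idt_right)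
  ultimately show ?thesis
    unfolding equivalent_categories_def by blast
qed

section \<open>Modules with connection form a category\<close>

lemma right_module_hom_compose:
  assumes "right_module R L" "f \<in> right_module_hom R L M" "g \<in> right_module_hom R M N"
  shows "compose (carrier L) g f \<in> right_module_hom R L N"
proof -
  interpret right_module R L by fact
  show ?thesis
    using assms(2,3)
    by (auto simp: right_module_hom_def compose_def PiE_iff ract_closed)
qed

lemma compose_restrict_id: "f \<in> extensional A \<Longrightarrow> compose A f (\<lambda>x\<in>A. x) = f"
  by (auto simp: compose_def extensional_def)

lemma category_Vect: "category (Vect T \<theta> \<omega>)"
proof
  fix X Y Z :: "'a nc_bundle" and f g
  assume *: "X \<in> Obj (Vect T \<theta> \<omega>)" "Y \<in> Obj (Vect T \<theta> \<omega>)" "Z \<in> Obj (Vect T \<theta> \<omega>)"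
    and f: "f \<in> Hom (Vect T \<theta> \<omega>) X Y" and g: "g \<in> Hom (Vect T \<theta> \<omega>) Y Z"
  obtain E D E' D' E'' D'' where [simp]: "X = (E, D)" "Y = (E', D')" "Z = (E'', D'')"
    by (metis surj_pair)
  have "compose (carrier E) g f \<in> right_module_hom (nc_torus \<theta>) E E''"
    by (rule right_module_hom_compose) (use * f g in \<open>auto simp: Vect_def\<close>)
  then show "Cmp (Vect T \<theta> \<omega>) X Y Z g f \<in> Hom (Vect T \<theta> \<omega>) X Z"
    using * f g
    by (auto simp: Vect_def nc_connection_def compose_def right_module_hom_def PiE_iff)
next
  fix X :: "'a nc_bundle"
  assume *: "X \<in> Obj (Vect T \<theta> \<omega>)"
  obtain E D where [simp]: "X = (E, D)" by (metis surj_pair)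
  interpret right_module "nc_torus \<theta>" E using * by (simp add: Vect_def)
  show "Idt (Vect T \<theta> \<omega>) X \<in> Hom (Vect T \<theta> \<omega>) X X"
    using * by (auto simp: Vect_def nc_connection_def right_module_hom_def PiE_iff ract_closed)
next
  fix W X Y Z :: "'a nc_bundle" and f g h
  assume f: "f \<in> Hom (Vect T \<theta> \<omega>) W X"
  \<comment> \<open>Extensional composition is associative once \<open>f\<close> lands in
    \<open>carrier (fst X)\<close>, the set to which the composite of \<open>h\<close> and
    \<open>g\<close> is restricted.\<close>
  have "f \<in> carrier (fst W) \<rightarrow> carrier (fst X)"
    using f by (auto simp: Vect_def right_module_hom_def split: prod.splits)
  then show "Cmp (Vect T \<theta> \<omega>) W X Z (Cmp (Vect T \<theta> \<omega>) X Y Z h g) f =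
      Cmp (Vect T \<theta> \<omega>) W Y Z h (Cmp (Vect T \<theta> \<omega>) W X Y g f)"
    by (auto simp: Vect_def compose_assoc[symmetric] split: prod.splits)
qed (auto simp: Vect_def right_module_hom_def PiE_iff compose_restrict_id Id_compose split: prod.splits)


section \<open>Restriction of scalars\<close>

text \<open>Only the action field changes, so a map between modules is literally the same function
  between their twists, and finite sums coincide.\<close>

definition restrict_scalars ::
  "('a \<Rightarrow> 'a) \<Rightarrow> ('a, 'm, 'x) right_mod_scheme \<Rightarrow> ('a, 'm, 'x) right_mod_scheme" where
  "restrict_scalars \<sigma> M = M\<lparr>ract := \<lambda>x a. x \<triangleleft>\<^bsub>M\<^esub> \<sigma> a\<rparr>"

lemma restrict_scalars_simps [simp]:
  "carrier (restrict_scalars \<sigma> M) = carrier M"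
  "add (restrict_scalars \<sigma> M) = add M"
  "zero (restrict_scalars \<sigma> M) = zero M"
  "ract (restrict_scalars \<sigma> M) = (\<lambda>x a. x \<triangleleft>\<^bsub>M\<^esub> \<sigma> a)"
  by (simp_all add: restrict_scalars_def)

lemma restrict_scalars_restrict_scalars:
  "(\<And>a. \<sigma> (\<sigma>' a) = a) \<Longrightarrow> restrict_scalars \<sigma>' (restrict_scalars \<sigma> M) = M"
  by (simp add: restrict_scalars_def)

lemma finsum_restrict_scalars [simp]: "finsum (restrict_scalars \<sigma> M) = finsum M"
  by (simp add: finsum_def fun_eq_iff)

lemma abelian_group_restrict_scalars [simp]:
  "abelian_group (restrict_scalars \<sigma> M) \<longleftrightarrow> abelian_group M"
  by (simp add: abelian_group_def abelian_monoid_def abelian_group_axioms_def)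

lemma right_module_restrict_scalars:
  assumes "right_module R M" "\<sigma> \<in> ring_hom R R"
  shows "right_module R (restrict_scalars \<sigma> M)"
proof -
  interpret right_module R M by fact
  note ring_hom_closed[OF assms(2), simp]
  show ?thesis
    by (intro right_module.intro right_module_axioms.intro)
      (simp_all add: R.ring_axioms M.abelian_group_axioms ract_closed ract_add_left ract_add_right
        ract_mult ract_one ring_hom_add[OF assms(2)] ring_hom_mult[OF assms(2)]
        ring_hom_one[OF assms(2)])
qed

text \<open>Transport of structure. The zero of \<open>N\<close> is a record field of its own, so
  its agreement with the image of the zero of \<open>M\<close> is assumed separately.\<close>

lemma right_module_bij:
  assumes "right_module R M" and bij: "bij_betw T (carrier M) (carrier N)"
    and add: "\<And>x y. \<lbrakk>x \<in> carrier M; y \<in> carrier M\<rbrakk> \<Longrightarrow> T (x \<oplus>\<^bsub>M\<^esub> y) = T x \<oplus>\<^bsub>N\<^esub> T y"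
    and zero: "T \<zero>\<^bsub>M\<^esub> = \<zero>\<^bsub>N\<^esub>"
    and ract: "\<And>x a. \<lbrakk>x \<in> carrier M; a \<in> carrier R\<rbrakk> \<Longrightarrow> T (x \<triangleleft>\<^bsub>M\<^esub> a) = T x \<triangleleft>\<^bsub>N\<^esub> a"
  shows "right_module R N"
proof -
  interpret right_module R M by fact
  have N: "carrier N = T ` carrier M" using bij by (simp add: bij_betw_def)
  \<comment> \<open>In this direction the equations turn operations of \<open>N\<close> on values of
    \<open>T\<close> into values of \<open>T\<close>, and each law for \<open>N\<close> becomes
    \<open>T\<close> applied to a law for \<open>M\<close>.\<close>
  note s [simp] = add[symmetric] zero[symmetric] ract[symmetric]
  have "abelian_group N"
  proof (rule abelian_groupI)
    fix x assume "x \<in> carrier N"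
    then obtain x' where "x' \<in> carrier M" "x = T x'" by (auto simp: N)
    then show "\<exists>y\<in>carrier N. y \<oplus>\<^bsub>N\<^esub> x = \<zero>\<^bsub>N\<^esub>"
      by (intro bexI[of _ "T (\<ominus>\<^bsub>M\<^esub> x')"]) (auto simp: N M.l_neg)
  qed (auto simp: N M.a_ac)
  then show ?thesis
    by (intro right_module.intro right_module_axioms.intro R.ring_axioms)
      (auto simp: N ract_closed ract_add_left ract_add_right ract_mult ract_one)
qed

text \<open>Entrywise \<open>\<sigma>'\<close> is semilinear: it sends \<open>v \<sigma>(a)\<close>
  to \<open>\<sigma>'(v) a\<close>. Hence it identifies \<open>P\<close> twisted by
  \<open>\<sigma>\<close> with its image under the ordinary action, and the module laws carry
  over.\<close>

lemma right_submodule_restrict_scalars_image: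
  assumes P: "right_submodule R P (free_right_module R I)"
    and \<sigma>: "\<sigma> \<in> ring_hom R R" and \<sigma>': "\<sigma>' \<in> ring_hom R R"
    and \<sigma>\<sigma>': "\<And>a. \<sigma> (\<sigma>' a) = a" and \<sigma>'\<sigma>: "\<And>a. \<sigma>' (\<sigma> a) = a"
  shows "right_submodule R ((\<lambda>v. \<sigma>' \<circ> v) ` P) (free_right_module R I)"
proof -
  let ?F = "free_right_module R I"
  interpret right_module R "?F\<lparr>carrier := P\<rparr>"
    using P by (simp add: right_submodule_def)
  have P': "P \<subseteq> carrier ?F" using P by (simp add: right_submodule_def)
  have zero: "\<sigma>' \<zero>\<^bsub>R\<^esub> = \<zero>\<^bsub>R\<^esub>"
    using ring_hom_zero[OF \<sigma>'] R.ring_axioms by blast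
  have car: "v i \<in> carrier R" if "v \<in> P" for v i
    using P' that by (auto simp: free_right_module_def)
  have "\<sigma>' \<circ> v \<in> carrier ?F" if "v \<in> P" for v
  proof -
    have v: "v \<in> carrier ?F" using P' that by blast
    then have "finite {i. v i \<noteq> \<zero>\<^bsub>R\<^esub>}" by (simp add: free_right_module_def)
    then have "finite {i. \<sigma>' (v i) \<noteq> \<zero>\<^bsub>R\<^esub>}" by (rule rev_finite_subset) (auto simp: zero)
    then show ?thesis
      using v by (auto simp: free_right_module_def zero ring_hom_closed[OF \<sigma>'])
  qed
  moreover have "right_module R (?F\<lparr>carrier := (\<lambda>v. \<sigma>' \<circ> v) ` P\<rparr>)"
  proof (rule right_module_bij[OF right_module_restrict_scalars[OF right_module_axioms \<sigma>]])
    have "inj_on (\<lambda>v. \<sigma>' \<circ> v) P"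
      by (rule inj_onI) (metis \<sigma>\<sigma>' comp_apply ext)
    then show "bij_betw (\<lambda>v. \<sigma>' \<circ> v) (carrier (restrict_scalars \<sigma> (?F\<lparr>carrier := P\<rparr>)))
        (carrier (?F\<lparr>carrier := (\<lambda>v. \<sigma>' \<circ> v) ` P\<rparr>))"
      by (simp add: bij_betw_def)
  qed (auto simp: free_right_module_def fun_eq_iff zero car \<sigma>'\<sigma> ring_hom_add[OF \<sigma>']
      ring_hom_mult[OF \<sigma>'] ring_hom_closed[OF \<sigma>])
  ultimately show ?thesis
    by (auto simp: right_submodule_def)
qed

text \<open>A free module twisted by an automorphism is free again, through entrywise
  \<open>\<sigma>'\<close>. This map carries the splitting into \<open>P\<close> and
  \<open>Q\<close> to a splitting into their images, and following \<open>f\<close> by it identifies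
  the twist of \<open>M\<close> with the image of \<open>P\<close>.\<close>

lemma projective_restrict_scalars:
  fixes R :: "('a, 'r) ring_scheme" and M :: "('a, 'm, 'x) right_mod_scheme"
  assumes mod: "right_module R M" and proj: "projective R M"
    and \<sigma>: "\<sigma> \<in> ring_hom R R" and \<sigma>': "\<sigma>' \<in> ring_hom R R"
    and \<sigma>\<sigma>': "\<And>a. \<sigma> (\<sigma>' a) = a" and \<sigma>'\<sigma>: "\<And>a. \<sigma>' (\<sigma> a) = a"
  shows "projective R (restrict_scalars \<sigma> M)"
proof -
  interpret right_module R M by (rule mod)
  from proj obtain I :: "'m set" and P Q f where
    P: "right_submodule R P (free_right_module R I)" and
    Q: "right_submodule R Q (free_right_module R I)" and
    decomp: "\<forall>v \<in> carrier (free_right_module R I).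
        \<exists>!(p, q). p \<in> P \<and> q \<in> Q \<and> v = p \<oplus>\<^bsub>free_right_module R I\<^esub> q" and
    f: "f \<in> right_module_hom R M ((free_right_module R I)\<lparr>carrier := P\<rparr>)"
      "bij_betw f (carrier M) P"
    unfolding projective_def by blast
  let ?F = "free_right_module R I"
  let ?T = "\<lambda>v. \<sigma>' \<circ> v"
  have car: "v i \<in> carrier R" if "v \<in> P \<union> Q" for v i
    using P Q that by (auto simp: right_submodule_def free_right_module_def)
  have zero: "\<sigma> \<zero>\<^bsub>R\<^esub> = \<zero>\<^bsub>R\<^esub>"
    using ring_hom_zero[OF \<sigma>] R.ring_axioms by blast
  have injT: "inj_on ?T A" for A :: "('m \<Rightarrow> 'a) set"
    by (rule inj_onI) (metis \<sigma>\<sigma>' comp_apply ext)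
  have T_add: "?T (p \<oplus>\<^bsub>?F\<^esub> q) = ?T p \<oplus>\<^bsub>?F\<^esub> ?T q" if "p \<in> P \<union> Q" "q \<in> P \<union> Q" for p q
    using that by (auto simp: free_right_module_def fun_eq_iff ring_hom_add[OF \<sigma>'] car)
  have decomp': "\<exists>!(p, q). p \<in> ?T ` P \<and> q \<in> ?T ` Q \<and> v = p \<oplus>\<^bsub>?F\<^esub> q"
    if v: "v \<in> carrier ?F" for v
  proof -
    have "finite {i. v i \<noteq> \<zero>\<^bsub>R\<^esub>}" using v by (simp add: free_right_module_def)
    then have "finite {i. \<sigma> (v i) \<noteq> \<zero>\<^bsub>R\<^esub>}" by (rule rev_finite_subset) (auto simp: zero)
    \<comment> \<open>To split \<open>v\<close>, one splits \<open>\<sigma> \<circ> v\<close> by the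
      given decomposition and pushes both summands forward with \<open>\<sigma>'\<close>.\<close>
    then have "\<sigma> \<circ> v \<in> carrier ?F"
      using v by (auto simp: free_right_module_def zero ring_hom_closed[OF \<sigma>])
    with decomp have ex1: "\<exists>!(p, q). p \<in> P \<and> q \<in> Q \<and> \<sigma> \<circ> v = p \<oplus>\<^bsub>?F\<^esub> q"
      by (rule bspec)
    then obtain p q where pq: "p \<in> P" "q \<in> Q" "\<sigma> \<circ> v = p \<oplus>\<^bsub>?F\<^esub> q"
      by (elim ex1E) auto
    have uniq: "(p', q') = (p, q)" if "p' \<in> P" "q' \<in> Q" "\<sigma> \<circ> v = p' \<oplus>\<^bsub>?F\<^esub> q'" for p' q'
      by (rule Uniq_D[OF conjunct2[OF ex1[unfolded ex1_iff_ex_Uniq]]]) (use pq that in simp_all)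
    \<comment> \<open>This moves any splitting of \<open>v\<close> back to one of
      \<open>\<sigma> \<circ> v\<close>, so uniqueness is inherited along with existence.\<close>
    have eq: "v = ?T w \<longleftrightarrow> \<sigma> \<circ> v = w" for w
      by (simp add: fun_eq_iff) (metis \<sigma>\<sigma>' \<sigma>'\<sigma>)
    show ?thesis
    proof (rule ex1I[of _ "(?T p, ?T q)"])
      show "case (?T p, ?T q) of (p, q) \<Rightarrow> p \<in> ?T ` P \<and> q \<in> ?T ` Q \<and> v = p \<oplus>\<^bsub>?F\<^esub> q"
        using pq by (simp add: T_add[symmetric] eq)
    next
      fix x
      assume "case x of (p, q) \<Rightarrow> p \<in> ?T ` P \<and> q \<in> ?T ` Q \<and> v = p \<oplus>\<^bsub>?F\<^esub> q"
      then obtain p' q' where "x = (?T p', ?T q')" "p' \<in> P" "q' \<in> Q" "v = ?T p' \<oplus>\<^bsub>?F\<^esub> ?T q'"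
        by auto
      then show "x = (?T p, ?T q)"
        using uniq[of p' q'] by (simp add: T_add[symmetric] eq)
    qed
  qed
  have fP: "f x \<in> P" if "x \<in> carrier M" for x
    using f(2) that by (auto simp: bij_betw_def)
  have bij: "bij_betw (restrict (\<lambda>x. ?T (f x)) (carrier M)) (carrier M) (?T ` P)"
    using bij_betw_trans[OF f(2) inj_on_imp_bij_betw[OF injT[of P]]]
    by (simp add: comp_def cong: bij_betw_cong)
  have hom: "restrict (\<lambda>x. ?T (f x)) (carrier M)
      \<in> right_module_hom R (restrict_scalars \<sigma> M) (?F\<lparr>carrier := ?T ` P\<rparr>)"
    using f(1)
    by (auto simp: right_module_hom_def fP ract_closed ring_hom_closed[OF \<sigma>] T_add,
        auto simp: free_right_module_def fun_eq_iff ring_hom_mult[OF \<sigma>'] \<sigma>'\<sigma> fP car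
          ring_hom_closed[OF \<sigma>])
  show ?thesis
    unfolding projective_def restrict_scalars_simps
  proof (intro exI conjI ballI bexI)
    show "right_submodule R (?T ` P) ?F" "right_submodule R (?T ` Q) ?F"
      by (rule right_submodule_restrict_scalars_image[OF P \<sigma> \<sigma>' \<sigma>\<sigma>' \<sigma>'\<sigma>]
          right_submodule_restrict_scalars_image[OF Q \<sigma> \<sigma>' \<sigma>\<sigma>' \<sigma>'\<sigma>])+
  qed (fact decomp' bij hom)+
qed

text \<open>The same generators work: a coefficient \<open>c s\<close> is replaced by
  \<open>\<sigma>' (c s)\<close>, which the twisted action turns back into
  \<open>c s\<close>.\<close>

lemma finitely_generated_restrict_scalars:
  assumes "finitely_generated R M" and \<sigma>': "\<sigma>' \<in> ring_hom R R" and \<sigma>\<sigma>': "\<And>a. \<sigma> (\<sigma>' a) = a"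
  shows "finitely_generated R (restrict_scalars \<sigma> M)"
proof -
  obtain S where S: "finite S" "S \<subseteq> carrier M"
    "\<forall>x \<in> carrier M. \<exists>c \<in> S \<rightarrow> carrier R. x = (\<Oplus>\<^bsub>M\<^esub>s\<in>S. s \<triangleleft>\<^bsub>M\<^esub> c s)"
    using assms(1) unfolding finitely_generated_def by blast
  have "\<exists>c \<in> S \<rightarrow> carrier R. x = (\<Oplus>\<^bsub>M\<^esub>s\<in>S. s \<triangleleft>\<^bsub>M\<^esub> \<sigma> (c s))" if x: "x \<in> carrier M" for x
  proof -
    obtain c where c: "c \<in> S \<rightarrow> carrier R" "x = (\<Oplus>\<^bsub>M\<^esub>s\<in>S. s \<triangleleft>\<^bsub>M\<^esub> c s)"
      using bspec[OF S(3) x] by (rule bexE)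
    then have "x = (\<Oplus>\<^bsub>M\<^esub>s\<in>S. s \<triangleleft>\<^bsub>M\<^esub> \<sigma> (\<sigma>' (c s)))"
      by (simp only: \<sigma>\<sigma>')
    moreover have "(\<lambda>s. \<sigma>' (c s)) \<in> S \<rightarrow> carrier R"
      using c(1) ring_hom_closed[OF \<sigma>'] by blast
    ultimately show ?thesis by (rule bexI)
  qed
  then show ?thesis
    unfolding finitely_generated_def restrict_scalars_simps finsum_restrict_scalars
    using S(1,2) by blast
qed

text \<open>Since \<open>\<sigma>\<close> maps the carrier of \<open>R\<close> onto itself,
  commuting with the action of every \<open>\<sigma> a\<close> is the same as commuting with the
  action of every \<open>a\<close>.\<close>

lemma right_module_hom_restrict_scalars:
  assumes \<sigma>: "\<sigma> \<in> ring_hom R R" and \<sigma>': "\<sigma>' \<in> ring_hom R R" and \<sigma>\<sigma>': "\<And>a. \<sigma> (\<sigma>' a) = a"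
  shows "right_module_hom R (restrict_scalars \<sigma> M) (restrict_scalars \<sigma> N) = right_module_hom R M N"
proof -
  have "(\<forall>a\<in>carrier R. A (\<sigma> a)) \<longleftrightarrow> (\<forall>a\<in>carrier R. A a)" for A
    by (metis \<sigma>\<sigma>' ring_hom_closed[OF \<sigma>] ring_hom_closed[OF \<sigma>'])
  from this[where A = "\<lambda>a. f (x \<triangleleft>\<^bsub>M\<^esub> a) = f x \<triangleleft>\<^bsub>N\<^esub> a" for f x]
  show ?thesis
    by (simp add: right_module_hom_def)
qed

section \<open>Twisting modules with connection by an automorphism\<close>

lemma Vect_Obj_restrict_scalars:
  assumes X: "(E, D) \<in> Obj (Vect T \<theta> \<omega>)"
    and \<sigma>: "\<sigma> \<in> ring_hom (nc_torus \<theta>) (nc_torus \<theta>)" and \<sigma>': "\<sigma>' \<in> ring_hom (nc_torus \<theta>) (nc_torus \<theta>)"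
    and inv: "\<And>a. \<sigma> (\<sigma>' a) = a" "\<And>a. \<sigma>' (\<sigma> a) = a"
    and scalar: "\<And>c. \<sigma> (nc_scalar c) = nc_scalar c"
    and delta: "\<And>a. nc_delta \<omega> (\<sigma> a) = \<sigma> (nc_delta \<omega>' a)"
  shows "(restrict_scalars \<sigma> E, D) \<in> Obj (Vect T \<theta> \<omega>')"
proof -
  have mod: "right_module (nc_torus \<theta>) E" using X by (simp add: Vect_def)
  \<comment> \<open>The twisted Leibniz rule at \<open>a\<close> is the old rule at
    \<open>\<sigma> a\<close>, because \<open>nc_delta \<omega> (\<sigma> a)\<close> acts as
    \<open>nc_delta \<omega>' a\<close> does after twisting. Complex linearity survives because
    \<open>\<sigma>\<close> fixes scalars.\<close>
  have "nc_connection \<theta> \<omega>' (restrict_scalars \<sigma> E) D"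
    using X by (auto simp: Vect_def nc_connection_def scalar delta[symmetric] ring_hom_closed[OF \<sigma>])
  then show ?thesis
    using X mod right_module_restrict_scalars[OF mod \<sigma>]
      finitely_generated_restrict_scalars[OF _ \<sigma>' inv(1)]
      projective_restrict_scalars[OF mod _ \<sigma> \<sigma>' inv]
    by (auto simp: Vect_def)
qed

lemma Vect_equivalent_if_automorphism:
  assumes \<sigma>: "\<sigma> \<in> ring_hom (nc_torus \<theta>) (nc_torus \<theta>)" and \<sigma>': "\<sigma>' \<in> ring_hom (nc_torus \<theta>) (nc_torus \<theta>)"
    and inv: "\<And>a. \<sigma> (\<sigma>' a) = a" "\<And>a. \<sigma>' (\<sigma> a) = a"
    and scalar: "\<And>c. \<sigma> (nc_scalar c) = nc_scalar c"
    and delta: "\<And>a. nc_delta \<omega> (\<sigma> a) = \<sigma> (nc_delta \<omega>' a)"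
  shows "equivalent_categories (Vect T \<theta> \<omega>) (Vect T \<theta> \<omega>')"
proof -
  \<comment> \<open>The inverse inherits both compatibilities, with \<open>\<omega>\<close> and
    \<open>\<omega>'\<close> exchanged, so twisting by \<open>\<sigma>'\<close> leads back to the
    first category.\<close>
  have scalar': "\<sigma>' (nc_scalar c) = nc_scalar c" for c
    by (metis inv(2) scalar)
  have delta': "nc_delta \<omega>' (\<sigma>' a) = \<sigma>' (nc_delta \<omega> a)" for a
    by (metis inv delta)
  show ?thesis
  proof (rule equivalent_categories_if_iso[OF category_Vect category_Vect,
        where \<Phi> = "\<lambda>(E, D). (restrict_scalars \<sigma> E, D)"
        and \<Psi> = "\<lambda>(E, D). (restrict_scalars \<sigma>' E, D)"])
    show "(case X of (E, D) \<Rightarrow> (restrict_scalars \<sigma> E, D)) \<in> Obj (Vect T \<theta> \<omega>')"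
      if "X \<in> Obj (Vect T \<theta> \<omega>)" for X
      using that by (cases X) (auto intro: Vect_Obj_restrict_scalars[where \<sigma> = \<sigma> and \<sigma>' = \<sigma>', OF _ \<sigma> \<sigma>' inv scalar delta])
    show "(case X of (E, D) \<Rightarrow> (restrict_scalars \<sigma>' E, D)) \<in> Obj (Vect T \<theta> \<omega>)"
      if "X \<in> Obj (Vect T \<theta> \<omega>')" for X
      using that by (cases X) (auto intro: Vect_Obj_restrict_scalars[where \<sigma> = \<sigma>' and \<sigma>' = \<sigma>, OF _ \<sigma>' \<sigma> inv(2,1) scalar' delta'])
  qed (auto simp: restrict_scalars_restrict_scalars inv Vect_def
      right_module_hom_restrict_scalars[OF \<sigma> \<sigma>' inv(1)] split: prod.splits)
qed


section \<open>Automorphisms of the noncommutative torus\<close>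

definition lin2 :: "int \<Rightarrow> int \<Rightarrow> int \<Rightarrow> int \<Rightarrow> int \<times> int \<Rightarrow> int \<times> int" where
  "lin2 p q r s n = (p * fst n + q * snd n, r * fst n + s * snd n)"

lemma lin2_diff: "lin2 p q r s (m - n) = lin2 p q r s m - lin2 p q r s n"
  by (simp add: lin2_def algebra_simps)

text \<open>The outer matrix is the adjugate, which is the inverse for determinant 1.\<close>

lemma lin2_inverse:
  assumes "p * s - q * r = 1"
  shows "lin2 s (- q) (- r) p (lin2 p q r s n) = n"
proof -
  have "lin2 s (- q) (- r) p (lin2 p q r s n) = ((p * s - q * r) * fst n, (p * s - q * r) * snd n)"
    by (simp add: lin2_def algebra_simps)
  then show ?thesis using assms by simp
qed

text \<open>The coefficient of \<open>a\<close> at the Weyl-ordered generator with exponent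
  \<open>n\<close> is \<open>a n\<close> times \<open>cis (- pi * \<theta> * n1 * n2)\<close>. In
  these coefficients the formula is plain precomposition with \<open>h\<close>; the phase converts
  to and from the basis \<open>U1^n1 U2^n2\<close>.\<close>

definition nc_pull :: "real \<Rightarrow> (int \<times> int \<Rightarrow> int \<times> int) \<Rightarrow> nc_fun \<Rightarrow> nc_fun" where
  "nc_pull \<theta> h a =
    (\<lambda>n. cis (pi * \<theta> * of_int (fst n * snd n - fst (h n) * snd (h n))) * a (h n))"

text \<open>Pulling back is contravariant in \<open>h\<close>, and the two phases, at
  \<open>n\<close> and at \<open>h n\<close>, are opposite.\<close>

lemma nc_pull_inverse:
  assumes "\<And>n. h' (h n) = n"
  shows "nc_pull \<theta> h (nc_pull \<theta> h' a) = a"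
proof
  fix n
  have cancel: "cis (x * of_int j) * (cis (x * of_int (- j)) * z) = z" for x j z
    by (simp add: cis_mult mult.assoc[symmetric])
  show "nc_pull \<theta> h (nc_pull \<theta> h' a) n = a n"
    using cancel[of "pi * \<theta>" "fst n * snd n - fst (h n) * snd (h n)" "a n"]
    unfolding nc_pull_def minus_diff_eq assms .
qed

text \<open>A scalar is supported at exponent zero, which is the only exponent that the invertible
  matrix sends to zero, and the phase there is 1.\<close>

lemma nc_pull_scalar:
  assumes "p * s - q * r = 1"
  shows "nc_pull \<theta> (lin2 p q r s) (nc_scalar c) = nc_scalar c"
proof -
  have "lin2 p q r s n = (0, 0) \<longleftrightarrow> n = (0, 0)" for n
    using lin2_inverse[OF assms, of n] by (auto simp: lin2_def)
  moreover have zero: "lin2 p q r s (0, 0) = (0, 0)" by (simp add: lin2_def)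
  ultimately show ?thesis
    by (auto simp: zero nc_pull_def nc_scalar_def nc_monomial_def fun_eq_iff)
qed

text \<open>A matrix of size 2 multiplies the symplectic form by its determinant.\<close>

lemma lin2_symplectic:
  assumes "p * s - q * r = 1"
  shows "fst (lin2 p q r s m) * snd (lin2 p q r s n) - snd (lin2 p q r s m) * fst (lin2 p q r s n)
    = fst m * snd n - snd m * fst n"
proof -
  have "fst (lin2 p q r s m) * snd (lin2 p q r s n) - snd (lin2 p q r s m) * fst (lin2 p q r s n)
    = (p * s - q * r) * (fst m * snd n - snd m * fst n)"
    by (simp add: lin2_def algebra_simps)
  then show ?thesis using assms by simp
qed

lemma nc_pull_mult:
  assumes det: "p * s - q * r = 1"
  shows "nc_pull \<theta> (lin2 p q r s) (nc_mult \<theta> a b) =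
    nc_mult \<theta> (nc_pull \<theta> (lin2 p q r s) a) (nc_pull \<theta> (lin2 p q r s) b)"
proof
  fix n
  let ?h = "lin2 p q r s"
  let ?c = "\<lambda>n. pi * \<theta> * of_int (fst n * snd n - fst (?h n) * snd (?h n)) :: real"
  have bij: "bij ?h"
    by (rule o_bij[of "lin2 s (- q) (- r) p"])
      (use lin2_inverse[OF det] lin2_inverse[of s p "- q" "- r"] det
        in \<open>auto simp: fun_eq_iff algebra_simps\<close>)
  \<comment> \<open>With \<open>k = n - m\<close>, write \<open>2 * m2 * k1\<close> as
    \<open>m2 * k1 - m1 * k2\<close> plus \<open>m2 * k1 + m1 * k2\<close>. The first part is
    symplectic, hence invariant under \<open>?h\<close>. The second is the defect of additivity of
    \<open>n1 * n2\<close>, which the phases \<open>?c\<close> absorb.\<close>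
  have phase: "?c n + 2 * pi * \<theta> * of_int (snd (?h m) * fst (?h (n - m)))
      = ?c m + ?c (n - m) + 2 * pi * \<theta> * of_int (snd m * fst (n - m))" for m
  proof -
    have "fst n * snd n - fst (?h n) * snd (?h n) + 2 * (snd (?h m) * fst (?h (n - m)))
      = (fst m * snd m - fst (?h m) * snd (?h m))
        + (fst (n - m) * snd (n - m) - fst (?h (n - m)) * snd (?h (n - m)))
        + 2 * (snd m * fst (n - m))"
      using lin2_symplectic[OF det, of m "n - m"] by (simp add: lin2_diff algebra_simps)
    then have "pi * \<theta> * of_int (fst n * snd n - fst (?h n) * snd (?h n)
        + 2 * (snd (?h m) * fst (?h (n - m))))
      = pi * \<theta> * of_int ((fst m * snd m - fst (?h m) * snd (?h m))
        + (fst (n - m) * snd (n - m) - fst (?h (n - m)) * snd (?h (n - m)))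
        + 2 * (snd m * fst (n - m)))"
      by (rule arg_cong)
    then show ?thesis
      unfolding of_int_add of_int_mult[of 2] by (simp only: distrib_left of_int_numeral mult_ac)
  qed
  \<comment> \<open>The convolution index is substituted by \<open>?h m\<close>. Reindexing along a
    bijection and pulling out a constant are unconditional for \<open>infsum\<close>, so
    \<open>a\<close> and \<open>b\<close> may be arbitrary coefficient functions.\<close>
  have "nc_pull \<theta> ?h (nc_mult \<theta> a b) n = cis (?c n) * (\<Sum>\<^sub>\<infinity>m\<in>UNIV. a (?h m) * b (?h n - ?h m) *
      cis (2 * pi * \<theta> * of_int (snd (?h m) * fst (?h n - ?h m))))"
    unfolding nc_pull_def nc_mult_def
    by (subst infsum_reindex_bij_betw[OF bij, symmetric]) simp
  also have "\<dots> = (\<Sum>\<^sub>\<infinity>m\<in>UNIV. a (?h m) * b (?h (n - m)) *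
      cis (?c n + 2 * pi * \<theta> * of_int (snd (?h m) * fst (?h (n - m)))))"
    by (subst infsum_cmult_right'[symmetric]) (simp only: lin2_diff cis_mult[symmetric] mult_ac)
  also have "\<dots> = nc_mult \<theta> (nc_pull \<theta> ?h a) (nc_pull \<theta> ?h b) n"
    unfolding phase nc_mult_def nc_pull_def by (simp only: cis_mult[symmetric] mult_ac)
  finally show "nc_pull \<theta> ?h (nc_mult \<theta> a b) n = nc_mult \<theta> (nc_pull \<theta> ?h a) (nc_pull \<theta> ?h b) n" .
qed

text \<open>Phases have modulus 1, and the inverse matrix stretches the weight of an exponent by at
  most a constant factor, so each weighted bound is only multiplied by a power of that
  factor.\<close>

lemma nc_pull_rapidly_decreasing:
  assumes det: "p * s - q * r = 1" and a: "rapidly_decreasing a"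
  shows "rapidly_decreasing (nc_pull \<theta> (lin2 p q r s) a)"
  unfolding rapidly_decreasing_def
proof
  fix k
  let ?N = "\<lambda>n::int \<times> int. 1 + \<bar>real_of_int (fst n)\<bar> + \<bar>real_of_int (snd n)\<bar>"
  let ?h = "lin2 p q r s"
  \<comment> \<open>The inverse matrix has the same entries up to order and sign, so this sum of
    absolute values bounds its stretching.\<close>
  define K where "K = 1 + real_of_int (\<bar>p\<bar> + \<bar>q\<bar> + \<bar>r\<bar> + \<bar>s\<bar>)"
  have growth: "?N n \<le> K * ?N (?h n)" for n
  proof -
    obtain x y where h: "?h n = (x, y)" by fastforce
    have "(s * x - q * y, p * y - r * x) = n"
      using lin2_inverse[OF det, of n] unfolding h by (simp add: lin2_def)
    then have n: "fst n = s * x - q * y" "snd n = p * y - r * x" by auto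
    \<comment> \<open>After multiplying out, the right side contains all terms of the left, and the
      surplus monomials are nonnegative; with the products as atoms the claim is linear.\<close>
    have expand: "1 + u + v \<le> (1 + (P + Q + R + S)) * (1 + X + Y)"
      if "u \<le> S * X + Q * Y" "v \<le> P * Y + R * X" "0 \<le> P" "0 \<le> Q" "0 \<le> R" "0 \<le> S" "0 \<le> X" "0 \<le> Y"
      for u v P Q R S X Y :: int
    proof -
      have "0 \<le> P * X" "0 \<le> Q * X" "0 \<le> R * Y" "0 \<le> S * Y" using that by simp_all
      with that show ?thesis unfolding distrib_left distrib_right mult_1_left mult_1_right by linarith
    qed
    have "1 + \<bar>fst n\<bar> + \<bar>snd n\<bar> \<le> (1 + (\<bar>p\<bar> + \<bar>q\<bar> + \<bar>r\<bar> + \<bar>s\<bar>)) * (1 + \<bar>x\<bar> + \<bar>y\<bar>)"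
      unfolding n by (rule expand) (auto simp: abs_mult[symmetric] intro: abs_triangle_ineq4)
    then have "real_of_int (1 + \<bar>fst n\<bar> + \<bar>snd n\<bar>)
        \<le> real_of_int ((1 + (\<bar>p\<bar> + \<bar>q\<bar> + \<bar>r\<bar> + \<bar>s\<bar>)) * (1 + \<bar>x\<bar> + \<bar>y\<bar>))"
      by (rule of_int_le_iff[THEN iffD2])
    then show ?thesis by (simp add: h K_def)
  qed
  obtain C where C: "\<And>n. ?N n ^ k * norm (a n) \<le> C"
    using a unfolding rapidly_decreasing_def by blast
  have "?N n ^ k * norm (nc_pull \<theta> ?h a n) \<le> K ^ k * C" for n
  proof -
    have "?N n ^ k * norm (a (?h n)) \<le> (K * ?N (?h n)) ^ k * norm (a (?h n))"
      by (intro mult_right_mono power_mono growth) auto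
    also have "\<dots> = K ^ k * (?N (?h n) ^ k * norm (a (?h n)))"
      by (simp add: power_mult_distrib mult.assoc)
    also have "\<dots> \<le> K ^ k * C"
      by (intro mult_left_mono C zero_le_power) (simp add: K_def)
    finally show ?thesis by (simp add: nc_pull_def norm_mult)
  qed
  then show "\<exists>C. \<forall>n. ?N n ^ k * norm (nc_pull \<theta> ?h a n) \<le> C" by blast
qed

lemma nc_pull_ring_hom:
  assumes det: "p * s - q * r = 1"
  shows "nc_pull \<theta> (lin2 p q r s) \<in> ring_hom (nc_torus \<theta>) (nc_torus \<theta>)"
proof (rule ring_hom_memI)
  have "nc_monomial (0, 0) = nc_scalar 1" by (simp add: nc_scalar_def)
  then show "nc_pull \<theta> (lin2 p q r s) \<one>\<^bsub>nc_torus \<theta>\<^esub> = \<one>\<^bsub>nc_torus \<theta>\<^esub>"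
    using nc_pull_scalar[OF det] by (simp add: nc_torus_def)
  show "nc_pull \<theta> (lin2 p q r s) (a \<oplus>\<^bsub>nc_torus \<theta>\<^esub> b) =
      nc_pull \<theta> (lin2 p q r s) a \<oplus>\<^bsub>nc_torus \<theta>\<^esub> nc_pull \<theta> (lin2 p q r s) b" for a b
    by (simp add: nc_torus_def nc_pull_def distrib_left)
qed (auto simp: nc_torus_def nc_pull_rapidly_decreasing[OF det] nc_pull_mult[OF det])

text \<open>The derivation for \<open>\<omega>\<close> multiplies the coefficient at
  \<open>n\<close> by \<open>2 * pi * \<i>\<close> times the pairing of \<open>\<omega>\<close> with
  \<open>n\<close>. Here \<open>\<omega>'\<close> is the transposed matrix applied to
  \<open>\<omega>\<close>, so pairing \<open>\<omega>'\<close> with \<open>n\<close> equals pairing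
  \<open>\<omega>\<close> with the image of \<open>n\<close>.\<close>

lemma nc_delta_pull:
  assumes "\<omega>' $ 1 = of_int p * \<omega> $ 1 + of_int r * \<omega> $ 2"
    and "\<omega>' $ 2 = of_int q * \<omega> $ 1 + of_int s * \<omega> $ 2"
  shows "nc_delta \<omega>' (nc_pull \<theta> (lin2 p q r s) a) = nc_pull \<theta> (lin2 p q r s) (nc_delta \<omega> a)"
proof
  fix n
  \<comment> \<open>Here \<open>c\<close> stands for \<open>2 * pi * \<i>\<close>, \<open>z\<close>
    for the phase and \<open>u\<close> for the coefficient of \<open>a\<close>.\<close>
  have "(of_int p * w1 + of_int r * w2) * (c * of_int (fst n) * (z * u))
      + (of_int q * w1 + of_int s * w2) * (c * of_int (snd n) * (z * u))
    = z * (w1 * (c * of_int (p * fst n + q * snd n) * u)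
      + w2 * (c * of_int (r * fst n + s * snd n) * u))" for w1 w2 c z u :: complex
    by (simp only: of_int_add of_int_mult ring_distribs mult_ac add_ac)
  then show "nc_delta \<omega>' (nc_pull \<theta> (lin2 p q r s) a) n =
      nc_pull \<theta> (lin2 p q r s) (nc_delta \<omega> a) n"
    unfolding nc_delta_def nc_delta1_def nc_delta2_def nc_pull_def lin2_def fst_conv snd_conv assms .
qed

lemma Vect_equivalent_SL2:
  fixes g :: "int ^ 2 ^ 2"
  assumes "det g = 1"
  shows "equivalent_categories (Vect T \<theta> (map_matrix of_int g *v \<omega>)) (Vect T \<theta> \<omega>)"
proof -
  \<comment> \<open>These are the entries of the transpose of \<open>g\<close>, since
    \<open>nc_delta_pull\<close> transposes once more.\<close>
  define p q r s where "p = g $ 1 $ 1" and "q = g $ 2 $ 1" and "r = g $ 1 $ 2" and "s = g $ 2 $ 2"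
  have det: "p * s - q * r = 1" and det': "s * p - (- q) * (- r) = 1"
    using assms by (simp_all add: det_2 p_def q_def r_def s_def mult.commute)
  show ?thesis
  proof (rule Vect_equivalent_if_automorphism)
    show "nc_pull \<theta> (lin2 p q r s) \<in> ring_hom (nc_torus \<theta>) (nc_torus \<theta>)"
      by (rule nc_pull_ring_hom[OF det])
    show "nc_pull \<theta> (lin2 s (- q) (- r) p) \<in> ring_hom (nc_torus \<theta>) (nc_torus \<theta>)"
      by (rule nc_pull_ring_hom[OF det'])
    show "nc_pull \<theta> (lin2 p q r s) (nc_pull \<theta> (lin2 s (- q) (- r) p) a) = a" for a
      by (rule nc_pull_inverse) (rule lin2_inverse[OF det])
    show "nc_pull \<theta> (lin2 s (- q) (- r) p) (nc_pull \<theta> (lin2 p q r s) a) = a" for a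
      \<comment> \<open>The adjugate of the adjugate is the original matrix.\<close>
      by (rule nc_pull_inverse) (use lin2_inverse[OF det'] in simp)
    show "nc_pull \<theta> (lin2 p q r s) (nc_scalar c) = nc_scalar c" for c
      by (rule nc_pull_scalar[OF det])
    show "nc_delta (map_matrix of_int g *v \<omega>) (nc_pull \<theta> (lin2 p q r s) a) =
        nc_pull \<theta> (lin2 p q r s) (nc_delta \<omega> a)" for a
      by (rule nc_delta_pull)
        (simp_all add: matrix_vector_mult_def map_matrix_def sum_2 p_def q_def r_def s_def)
  qed
qed


section \<open>Rescaling the connection\<close>

lemma nc_mult_scalar_right: "nc_mult \<theta> a (nc_scalar c) = (\<lambda>n. c * a n)"
proof
  fix n
  \<comment> \<open>Only \<open>m = n\<close> contributes, and its twisting phase is 1 because the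
    second exponent is zero.\<close>
  have "nc_mult \<theta> a (nc_scalar c) n = (\<Sum>\<^sub>\<infinity>m\<in>{n}. a m * nc_scalar c (n - m) *
        cis (2 * pi * \<theta> * of_int (snd m * fst (n - m))))"
    unfolding nc_mult_def
    by (rule infsum_cong_neutral) (auto simp: nc_scalar_def nc_monomial_def prod_eq_iff)
  then show "nc_mult \<theta> a (nc_scalar c) n = c * a n"
    by (simp add: nc_scalar_def nc_monomial_def zero_prod_def)
qed

lemma nc_mult_scalar_left: "nc_mult \<theta> (nc_scalar c) a = (\<lambda>n. c * a n)"
proof
  fix n
  have "nc_mult \<theta> (nc_scalar c) a n = (\<Sum>\<^sub>\<infinity>m\<in>{(0, 0)}. nc_scalar c m * a (n - m) *
        cis (2 * pi * \<theta> * of_int (snd m * fst (n - m))))"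
    unfolding nc_mult_def
    by (rule infsum_cong_neutral) (auto simp: nc_scalar_def nc_monomial_def)
  then show "nc_mult \<theta> (nc_scalar c) a n = c * a n"
    by (simp add: nc_scalar_def nc_monomial_def zero_prod_def[symmetric])
qed

lemma nc_scalar_in_carrier [simp]: "nc_scalar c \<in> carrier (nc_torus \<theta>)"
  by (auto simp: nc_torus_def rapidly_decreasing_def nc_scalar_def nc_monomial_def
      intro!: exI[of _ "norm c"])

text \<open>A derivation costs one power of the weight: decay of order \<open>k\<close> for the
  result follows from decay of order \<open>Suc k\<close> for \<open>a\<close>.\<close>

lemma nc_delta_in_carrier [simp]:
  assumes "a \<in> carrier (nc_torus \<theta>)"
  shows "nc_delta \<omega> a \<in> carrier (nc_torus \<theta>)"
proof -
  have a: "rapidly_decreasing a" using assms by (simp add: nc_torus_def)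
  have "\<exists>C. \<forall>n. (1 + \<bar>real_of_int (fst n)\<bar> + \<bar>real_of_int (snd n)\<bar>) ^ k * norm (nc_delta \<omega> a n) \<le> C"
    (is "\<exists>C. \<forall>n. ?N n ^ k * _ \<le> C") for k
  proof -
    obtain C where C: "\<And>n. ?N n ^ Suc k * norm (a n) \<le> C"
      using a unfolding rapidly_decreasing_def by blast
    define K where "K = 2 * pi * (norm (\<omega> $ 1) + norm (\<omega> $ 2))"
    have bound: "norm (nc_delta \<omega> a n) \<le> K * ?N n * norm (a n)" for n
    proof -
      have "nc_delta \<omega> a n = 2 * of_real pi * \<i> * (\<omega> $ 1 * of_int (fst n) + \<omega> $ 2 * of_int (snd n)) * a n"
        by (simp add: nc_delta_def nc_delta1_def nc_delta2_def algebra_simps)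
      then have "norm (nc_delta \<omega> a n)
          = 2 * pi * norm (\<omega> $ 1 * of_int (fst n) + \<omega> $ 2 * of_int (snd n)) * norm (a n)"
        by (simp add: norm_mult)
      also have "\<dots> \<le> 2 * pi * ((norm (\<omega> $ 1) + norm (\<omega> $ 2)) * ?N n) * norm (a n)"
      proof (intro mult_right_mono mult_left_mono)
        have "norm (\<omega> $ 1 * of_int (fst n) + \<omega> $ 2 * of_int (snd n))
            \<le> norm (\<omega> $ 1) * \<bar>real_of_int (fst n)\<bar> + norm (\<omega> $ 2) * \<bar>real_of_int (snd n)\<bar>"
          by (rule norm_triangle_le) (simp add: norm_mult)
        also have "\<dots> \<le> norm (\<omega> $ 1) * ?N n + norm (\<omega> $ 2) * ?N n"
          by (intro add_mono mult_left_mono) auto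
        finally show "norm (\<omega> $ 1 * of_int (fst n) + \<omega> $ 2 * of_int (snd n))
            \<le> (norm (\<omega> $ 1) + norm (\<omega> $ 2)) * ?N n"
          by (simp add: distrib_right)
      qed auto
      finally show ?thesis by (simp add: K_def mult.assoc)
    qed
    have "?N n ^ k * norm (nc_delta \<omega> a n) \<le> K * C" for n
    proof -
      have "?N n ^ k * norm (nc_delta \<omega> a n) \<le> ?N n ^ k * (K * ?N n * norm (a n))"
        by (intro mult_left_mono bound) auto
      also have "\<dots> = K * (?N n ^ Suc k * norm (a n))" by simp
      also have "\<dots> \<le> K * C" by (intro mult_left_mono C) (simp add: K_def)
      finally show ?thesis .
    qed
    then show ?thesis by blast
  qed
  then show ?thesis by (simp add: nc_torus_def rapidly_decreasing_def)
qed

lemma nc_delta_scale: "nc_delta (c *s \<omega>) a = (\<lambda>n. c * nc_delta \<omega> a n)"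
  by (simp add: nc_delta_def algebra_simps)

text \<open>Restricting to the carrier keeps the map extensional, so rescaling by \<open>c\<close>
  and then by its inverse returns the very same object.\<close>

definition scale_connection :: "complex \<Rightarrow> 'm nc_bundle \<Rightarrow> 'm nc_bundle" where
  "scale_connection c = (\<lambda>(E, D). (E, \<lambda>e \<in> carrier E. D e \<triangleleft>\<^bsub>E\<^esub> nc_scalar c))"

text \<open>Scalars are central in the algebra, and the action is multiplicative.\<close>

lemma ract_scalar_commute:
  assumes "right_module (nc_torus \<theta>) E" "x \<in> carrier E" "a \<in> carrier (nc_torus \<theta>)"
  shows "x \<triangleleft>\<^bsub>E\<^esub> a \<triangleleft>\<^bsub>E\<^esub> nc_scalar c = x \<triangleleft>\<^bsub>E\<^esub> nc_scalar c \<triangleleft>\<^bsub>E\<^esub> a"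
proof -
  interpret right_module "nc_torus \<theta>" E by fact
  have "a \<otimes>\<^bsub>nc_torus \<theta>\<^esub> nc_scalar c = nc_scalar c \<otimes>\<^bsub>nc_torus \<theta>\<^esub> a"
    by (simp add: nc_torus_def nc_mult_scalar_left nc_mult_scalar_right)
  then show ?thesis
    using assms by (metis ract_mult nc_scalar_in_carrier)
qed

lemma ract_scalar_inverse:
  assumes "right_module (nc_torus \<theta>) E" "x \<in> carrier E" "c * d = 1"
  shows "x \<triangleleft>\<^bsub>E\<^esub> nc_scalar c \<triangleleft>\<^bsub>E\<^esub> nc_scalar d = x"
proof -
  interpret right_module "nc_torus \<theta>" E by fact
  have "nc_scalar c \<otimes>\<^bsub>nc_torus \<theta>\<^esub> nc_scalar d = \<one>\<^bsub>nc_torus \<theta>\<^esub>"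
    using assms(3)
    by (simp add: nc_torus_def nc_mult_scalar_left) (simp add: nc_scalar_def fun_eq_iff mult.assoc[symmetric])
  then show ?thesis
    using assms(2) by (metis ract_mult ract_one nc_scalar_in_carrier)
qed

text \<open>Multiply the Leibniz rule by \<open>c\<close>: in the first term centrality moves
  \<open>c\<close> next to \<open>D e\<close>, and in the second \<open>c\<close> is absorbed into
  the derivation, which is linear in \<open>\<omega>\<close>.\<close>

lemma Vect_Obj_scale_connection:
  assumes X: "X \<in> Obj (Vect T \<theta> \<omega>)"
  shows "scale_connection c X \<in> Obj (Vect T \<theta> (c *s \<omega>))"
proof -
  obtain E D where XE: "X = (E, D)" by fastforce
  have mod: "right_module (nc_torus \<theta>) E" and D: "nc_connection \<theta> \<omega> E D"
    using X by (simp_all add: Vect_def XE)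
  interpret right_module "nc_torus \<theta>" E by (rule mod)
  have Dc: "D x \<in> carrier E" if "x \<in> carrier E" for x
    using D that by (auto simp: nc_connection_def)
  have delta: "x \<triangleleft>\<^bsub>E\<^esub> nc_delta \<omega> a \<triangleleft>\<^bsub>E\<^esub> nc_scalar c = x \<triangleleft>\<^bsub>E\<^esub> nc_delta (c *s \<omega>) a"
    if "x \<in> carrier E" "a \<in> carrier (nc_torus \<theta>)" for x a
  proof -
    have "nc_delta \<omega> a \<otimes>\<^bsub>nc_torus \<theta>\<^esub> nc_scalar c = nc_delta (c *s \<omega>) a"
      by (simp add: nc_torus_def nc_mult_scalar_right nc_delta_scale)
    then show ?thesis
      using that ract_mult[of x "nc_delta \<omega> a" "nc_scalar c"] by simp
  qed
  have "nc_connection \<theta> (c *s \<omega>) E (\<lambda>e \<in> carrier E. D e \<triangleleft>\<^bsub>E\<^esub> nc_scalar c)"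
    unfolding nc_connection_def
  proof (intro conjI ballI allI)
    fix x y d a
    assume x: "x \<in> carrier E"
    show "(\<lambda>e \<in> carrier E. D e \<triangleleft>\<^bsub>E\<^esub> nc_scalar c) (x \<triangleleft>\<^bsub>E\<^esub> nc_scalar d) =
        (\<lambda>e \<in> carrier E. D e \<triangleleft>\<^bsub>E\<^esub> nc_scalar c) x \<triangleleft>\<^bsub>E\<^esub> nc_scalar d"
    proof -
      have "D (x \<triangleleft>\<^bsub>E\<^esub> nc_scalar d) = D x \<triangleleft>\<^bsub>E\<^esub> nc_scalar d"
        using D x unfolding nc_connection_def by blast
      then show ?thesis
        using x ract_scalar_commute[OF mod Dc[OF x], of "nc_scalar d" c] by (simp add: ract_closed)
    qed
    show "(\<lambda>e \<in> carrier E. D e \<triangleleft>\<^bsub>E\<^esub> nc_scalar c) (x \<oplus>\<^bsub>E\<^esub> y) =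
        (\<lambda>e \<in> carrier E. D e \<triangleleft>\<^bsub>E\<^esub> nc_scalar c) x \<oplus>\<^bsub>E\<^esub>
        (\<lambda>e \<in> carrier E. D e \<triangleleft>\<^bsub>E\<^esub> nc_scalar c) y" if "y \<in> carrier E"
      using D x that by (simp add: ract_closed ract_add_left Dc nc_connection_def)
    show "(\<lambda>e \<in> carrier E. D e \<triangleleft>\<^bsub>E\<^esub> nc_scalar c) (x \<triangleleft>\<^bsub>E\<^esub> a) =
        (\<lambda>e \<in> carrier E. D e \<triangleleft>\<^bsub>E\<^esub> nc_scalar c) x \<triangleleft>\<^bsub>E\<^esub> a \<oplus>\<^bsub>E\<^esub> x \<triangleleft>\<^bsub>E\<^esub> nc_delta (c *s \<omega>) a"
      if a: "a \<in> carrier (nc_torus \<theta>)"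
    proof -
      have "D (x \<triangleleft>\<^bsub>E\<^esub> a) = D x \<triangleleft>\<^bsub>E\<^esub> a \<oplus>\<^bsub>E\<^esub> x \<triangleleft>\<^bsub>E\<^esub> nc_delta \<omega> a"
        using D x a by (simp add: nc_connection_def)
      then show ?thesis
        using x a ract_scalar_commute[OF mod Dc[OF x] a, of c]
        by (simp add: ract_closed ract_add_left Dc delta)
    qed
  qed (auto simp: ract_closed Dc)
  then show ?thesis
    using X by (simp add: Vect_def XE scale_connection_def)
qed

lemma scale_connection_inverse:
  assumes X: "X \<in> Obj (Vect T \<theta> \<omega>)" and cd: "c * d = 1"
  shows "scale_connection d (scale_connection c X) = X"
proof -
  obtain E D where XE: "X = (E, D)" by (cases X)
  have mod: "right_module (nc_torus \<theta>) E" and D: "D \<in> carrier E \<rightarrow>\<^sub>E carrier E"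
    using X by (simp_all add: Vect_def XE nc_connection_def)
  have "(\<lambda>e \<in> carrier E. D e \<triangleleft>\<^bsub>E\<^esub> nc_scalar c \<triangleleft>\<^bsub>E\<^esub> nc_scalar d) = (\<lambda>e \<in> carrier E. D e)"
    by (rule restrict_ext, rule ract_scalar_inverse[OF mod _ cd]) (use D in auto)
  also have "\<dots> = D" using D by (simp add: PiE_def extensional_restrict)
  finally show ?thesis by (simp add: XE scale_connection_def cong: restrict_cong)
qed

text \<open>A module map commutes with the action of \<open>c\<close>, and that action is injective
  for nonzero \<open>c\<close>, so the factor cancels from the intertwining condition.\<close>

lemma Hom_scale_connection:
  assumes "X \<in> Obj (Vect T \<theta> \<omega>)" "Y \<in> Obj (Vect T \<theta> \<omega>)" "c \<noteq> 0"
  shows "Hom (Vect T \<theta> (c *s \<omega>)) (scale_connection c X) (scale_connection c Y) = Hom (Vect T \<theta> \<omega>) X Y"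
proof -
  obtain E D where X: "X = (E, D)" by (cases X)
  obtain E' D' where Y: "Y = (E', D')" by (cases Y)
  note XY = X Y
  have E': "right_module (nc_torus \<theta>) E'" using assms(2) by (simp add: Vect_def XY)
  have D: "D e \<in> carrier E" if "e \<in> carrier E" for e
    using assms(1) that by (auto simp: Vect_def XY nc_connection_def)
  have D': "D' e \<in> carrier E'" if "e \<in> carrier E'" for e
    using assms(2) that by (auto simp: Vect_def XY nc_connection_def)
  have inj: "x \<triangleleft>\<^bsub>E'\<^esub> nc_scalar c = y \<triangleleft>\<^bsub>E'\<^esub> nc_scalar c \<longleftrightarrow> x = y"
    if "x \<in> carrier E'" "y \<in> carrier E'" for x y
    using that ract_scalar_inverse[OF E', of _ c "1 / c"] \<open>c \<noteq> 0\<close>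
    by (metis nonzero_mult_div_cancel_left times_divide_eq_right)
  have "f (D e \<triangleleft>\<^bsub>E\<^esub> nc_scalar c) = D' (f e) \<triangleleft>\<^bsub>E'\<^esub> nc_scalar c \<longleftrightarrow> f (D e) = D' (f e)"
    if "f \<in> right_module_hom (nc_torus \<theta>) E E'" "e \<in> carrier E" for f e
  proof -
    have "f (D e \<triangleleft>\<^bsub>E\<^esub> nc_scalar c) = f (D e) \<triangleleft>\<^bsub>E'\<^esub> nc_scalar c"
      using that D by (auto simp: right_module_hom_def)
    moreover have "f (D e) \<in> carrier E'" "D' (f e) \<in> carrier E'"
      using that D D' by (auto simp: right_module_hom_def)
    ultimately show ?thesis by (simp add: inj)
  qed
  moreover have "f e \<in> carrier E'" if "f \<in> right_module_hom (nc_torus \<theta>) E E'" "e \<in> carrier E" for f e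
    using that by (auto simp: right_module_hom_def)
  ultimately show ?thesis
    by (auto simp: Vect_def XY scale_connection_def)
qed

lemma Vect_equivalent_scale:
  assumes "c \<noteq> 0"
  shows "equivalent_categories (Vect T \<theta> \<omega>) (Vect T \<theta> (c *s \<omega>))"
proof (rule equivalent_categories_if_iso[OF category_Vect category_Vect, where \<Phi> = "scale_connection c"
      and \<Psi> = "scale_connection (1 / c)"])
  show "scale_connection (1 / c) Y \<in> Obj (Vect T \<theta> \<omega>)" if "Y \<in> Obj (Vect T \<theta> (c *s \<omega>))" for Y
    using Vect_Obj_scale_connection[OF that, of "1 / c"] assms
    by (simp add: vector_smult_assoc)
  show "scale_connection c X \<in> Obj (Vect T \<theta> (c *s \<omega>))" if "X \<in> Obj (Vect T \<theta> \<omega>)" for X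
    using that by (rule Vect_Obj_scale_connection)
  show "scale_connection (1 / c) (scale_connection c X) = X" if "X \<in> Obj (Vect T \<theta> \<omega>)" for X
    using that by (rule scale_connection_inverse) (use assms in simp)
  show "scale_connection c (scale_connection (1 / c) Y) = Y" if "Y \<in> Obj (Vect T \<theta> (c *s \<omega>))" for Y
    using that by (rule scale_connection_inverse) (use assms in simp)
  show "Hom (Vect T \<theta> (c *s \<omega>)) (scale_connection c X) (scale_connection c Y) = Hom (Vect T \<theta> \<omega>) X Y"
    if "X \<in> Obj (Vect T \<theta> \<omega>)" "Y \<in> Obj (Vect T \<theta> \<omega>)" for X Y
    using that assms by (rule Hom_scale_connection)
qed (auto simp: Vect_def scale_connection_def split: prod.splits)

theorem proposition1:
  fixes \<theta> :: real and \<omega> :: "complex ^ 2"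
  assumes "\<theta> \<notin> \<rat>"
  shows "(\<forall>g :: int ^ 2 ^ 2. det g = 1 \<longrightarrow>
            equivalent_categories
              (Vect TYPE('m) \<theta> (map_matrix of_int g *v \<omega>)) (Vect TYPE('m) \<theta> \<omega>)) \<and>
         (\<forall>\<tau>. \<omega> $ 2 \<noteq> 0 \<and> \<tau> = \<omega> $ 1 / \<omega> $ 2 \<longrightarrow>
            equivalent_categories
              (Vect TYPE('m) \<theta> \<omega>) (Vect_tau TYPE('m) \<theta> \<tau>))"
proof (intro conjI allI impI)
  fix g :: "int ^ 2 ^ 2"
  assume "det g = 1"
  then show "equivalent_categories
      (Vect TYPE('m) \<theta> (map_matrix of_int g *v \<omega>)) (Vect TYPE('m) \<theta> \<omega>)"
    by (rule Vect_equivalent_SL2)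
next
  fix \<tau>
  assume *: "\<omega> $ 2 \<noteq> 0 \<and> \<tau> = \<omega> $ 1 / \<omega> $ 2"
  \<comment> \<open>Dividing \<open>\<omega>\<close> by its second coordinate normalises that
    coordinate to 1 and leaves \<open>\<tau>\<close> as the first.\<close>
  then have "vector [\<tau>, 1] = (1 / \<omega> $ 2) *s \<omega>"
    by (simp add: vec_eq_iff forall_2)
  then show "equivalent_categories (Vect TYPE('m) \<theta> \<omega>) (Vect_tau TYPE('m) \<theta> \<tau>)"
    using Vect_equivalent_scale[of "1 / \<omega> $ 2"] * by (simp add: Vect_tau_def)
qed

end
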